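(* Let $\lambda>0$ and $\beta>1$ be given, with $$\beta-1-\frac{2^\gamma-1}{1-2^\gamma\epsilon^2}\,\frac{2}{\alpha-2}>0.$$ Set $M=\beta K$ and consider maximizing, over $K$, the energy efficiency metric $$G(K)=\frac{K\gamma}{\frac{K\rho^*}{\eta}+\mathcal{C}_0+\mathcal{C}_1K+\mathcal{D}_0M+\mathcal{D}_1MK+\mathcal{A}K\gamma},\qquad M=\beta K,$$ where $$\rho^*=\frac{\frac{2^\gamma-1}{1-2^\gamma\epsilon^2}\,\frac{\omega\sigma^2\,\Gamma(\alpha/2+1)}{(\pi\lambda)^{\alpha/2}}}{M-K-\frac{2^\gamma-1}{1-2^\gamma\epsilon^2}\,\frac{2K}{\alpha-2}}.$$ Over real $K>0$, $G$ is maximized by $$K^*=\sqrt{\frac{\frac{2^\gamma-1}{1-2^\gamma\epsilon^2}\,\frac{\omega\sigma^2\,\Gamma(\alpha/2+1)}{\eta(\pi\lambda)^{\alpha/2}}}{\beta\mathcal{D}_1\left(\beta-1-\frac{2^\gamma-1}{1-2^\gamma\epsilon^2}\,\frac{2}{\alpha-2}\right)}+\frac{\mathcal{C}_0}{\beta\mathcal{D}_1}}.$$ If $K^*$ is not an integer, then the optimum over positive integers $K$ is attained at either the closest smaller or the closest larger integer to $K^*$.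
   Context: Fixed parameters: $\alpha>2$, $\omega>0$, $\sigma^2>0$, $0\le\epsilon<1$, $\eta\in(0,1]$, positive constants $\mathcal{A},\mathcal{C}_0,\mathcal{C}_1,\mathcal{D}_0,\mathcal{D}_1$, and a target spectral efficiency $\gamma$ with $0\le\gamma<-2\log_2(\epsilon)$ (upper bound $+\infty$ if $\epsilon=0$), so that $1-2^\gamma\epsilon^2>0$. Here $\lambda$ is the density of access points, $K$ the number of users per access point, $M$ the number of antennas per access point, and $\rho^*$ the transmit energy per symbol. In this statement the ratio $\beta=M/K$ is held fixed while $K$ varies, and $M=\beta K$ is not required to be an integer. *)

theory Defs
  imports "HOL-Analysis.Gamma_Function"
begin

definition sinr_factor :: "real \<Rightarrow> real \<Rightarrow> real" where
  "sinr_factor \<gamma> \<epsilon> = (2 powr \<gamma> - 1) / (1 - 2 powr \<gamma> * \<epsilon>\<^sup>2)"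

text \<open>\<open>M\<close> antennas and \<open>K\<close> users per access point, both real; \<open>l\<close> is the density of access points.\<close>

definition rho_star ::
  "real \<Rightarrow> real \<Rightarrow> real \<Rightarrow> real \<Rightarrow> real \<Rightarrow> real \<Rightarrow> real \<Rightarrow> real \<Rightarrow> real" where
  "rho_star \<alpha> \<omega> \<sigma> \<epsilon> \<gamma> l M K =
     (sinr_factor \<gamma> \<epsilon> * (\<omega> * \<sigma>\<^sup>2 * Gamma (\<alpha> / 2 + 1) / (pi * l) powr (\<alpha> / 2)))
     / (M - K - sinr_factor \<gamma> \<epsilon> * (2 * K / (\<alpha> - 2)))"

definition energy_efficiency ::
  "real \<Rightarrow> real \<Rightarrow> real \<Rightarrow> real \<Rightarrow> real \<Rightarrow> real \<Rightarrow> real \<Rightarrow> real \<Rightarrow> real \<Rightarrow> real \<Rightarrow> real" where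
  "energy_efficiency A C0 C1 D0 D1 \<eta> \<gamma> \<rho> M K =
     K * \<gamma> / (K * \<rho> / \<eta> + C0 + C1 * K + D0 * M + D1 * M * K + A * K * \<gamma>)"

definition K_star ::
  "real \<Rightarrow> real \<Rightarrow> real \<Rightarrow> real \<Rightarrow> real \<Rightarrow> real \<Rightarrow> real \<Rightarrow> real \<Rightarrow> real \<Rightarrow> real \<Rightarrow> real" where
  "K_star \<alpha> \<omega> \<sigma> \<epsilon> \<gamma> l \<eta> C0 D1 \<beta> =
     sqrt (sinr_factor \<gamma> \<epsilon> * (\<omega> * \<sigma>\<^sup>2 * Gamma (\<alpha> / 2 + 1) / (\<eta> * (pi * l) powr (\<alpha> / 2)))
             / (\<beta> * D1 * (\<beta> - 1 - sinr_factor \<gamma> \<epsilon> * (2 / (\<alpha> - 2))))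
           + C0 / (\<beta> * D1))"

end

theory Submission
  imports Defs
begin

text \<open>For \<open>K > 0\<close> the term \<open>K * \<rho>\<close> does not depend on \<open>K\<close>, because the denominator of
  \<open>\<rho>\<close> is \<open>K\<close> times a constant. The metric is therefore \<open>K * \<gamma> / (p + q * K + r * K\<^sup>2)\<close>
  with constants \<open>p, q, r > 0\<close>, and comparing its values at \<open>x\<close> and \<open>y\<close> amounts to the sign of
  \<open>(y - x) * (p - r * x * y)\<close>. So it increases up to \<open>sqrt (p / r)\<close>, which is \<open>K\<^sup>*\<close>, and
  decreases afterwards; for such a function an optimal integer is adjacent to the real optimum.\<close>

text \<open>The upper bound on \<open>\<gamma>\<close> is
  \<open>2 powr \<gamma> * \<epsilon>\<^sup>2 < 1\<close> in logarithmic form, so the denominator is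
  positive; for \<open>\<epsilon> = 0\<close> this is immediate.\<close>

lemma sinr_factor_nonneg:
  assumes "0 \<le> \<epsilon>" "0 \<le> \<gamma>" "\<epsilon> > 0 \<longrightarrow> \<gamma> < - 2 * log 2 \<epsilon>"
  shows "sinr_factor \<gamma> \<epsilon> \<ge> 0"
proof -
  have "2 powr \<gamma> * \<epsilon>\<^sup>2 < 1"
  proof (cases "\<epsilon> = 0")
    case False
    then have \<epsilon>: "\<epsilon> > 0" using assms(1) by simp
    have "2 powr \<gamma> * \<epsilon>\<^sup>2 = 2 powr \<gamma> * 2 powr (log 2 (\<epsilon>\<^sup>2))"
      using \<epsilon> by simp
    also have "\<dots> = 2 powr (\<gamma> + 2 * log 2 \<epsilon>)"
      using \<epsilon> by (simp add: powr_add log_nat_power)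
    also have "\<dots> < 2 powr 0"
      using \<epsilon> assms(3) by (intro powr_less_mono) auto
    finally show ?thesis by simp
  qed simp
  moreover have "2 powr \<gamma> \<ge> 1"
    using assms(2) by (simp add: ge_one_powr_ge_zero)
  ultimately show ?thesis by (simp add: sinr_factor_def)
qed

text \<open>After cross-multiplication the terms \<open>q * x * y\<close> cancel, and the difference
  of the two sides is \<open>c\<close> times the product in the last hypothesis.\<close>

lemma ratio_le_ratioI:
  fixes c p q r x y :: real
  assumes "c \<ge> 0" "p > 0" "q > 0" "r > 0" "x > 0" "y > 0"
    and "(y - x) * (p - r * x * y) \<ge> 0"
  shows "x * c / (p + q * x + r * x\<^sup>2) \<le> y * c / (p + q * y + r * y\<^sup>2)"
proof -
  have pos: "p + q * z + r * z\<^sup>2 > 0" if "z > 0" for z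
    using assms that by (intro add_pos_pos) auto
  have "c * (x * (p + q * y + r * y\<^sup>2)) \<le> c * (y * (p + q * x + r * x\<^sup>2))"
    using assms(1,7) by (intro mult_left_mono) (auto simp: algebra_simps power2_eq_square)
  then show ?thesis
    using pos[OF assms(5)] pos[OF assms(6)] by (simp add: field_simps)
qed

text \<open>The hypothesis \<open>between\<close> places \<open>y\<close> between \<open>x\<close>
  and the peak, so one inequality covers both the increasing and the decreasing branch.\<close>

lemma ratio_unimodal:
  fixes c p q r x y :: real
  assumes "c \<ge> 0" "p > 0" "q > 0" "r > 0" "0 < x" "0 < y"
    and between: "x \<le> y \<and> y \<le> sqrt (p / r) \<or> sqrt (p / r) \<le> y \<and> y \<le> x"
  shows "x * c / (p + q * x + r * x\<^sup>2) \<le> y * c / (p + q * y + r * y\<^sup>2)"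
proof (rule ratio_le_ratioI)
  define s where "s = sqrt (p / r)"
  have s: "s \<ge> 0" "p = r * (s * s)"
    using assms by (simp_all add: s_def)
  show "(y - x) * (p - r * x * y) \<ge> 0"
  proof (cases "x \<le> y \<and> y \<le> s")
    case True
    \<comment> \<open>On either side of the peak, \<open>x * y\<close> is compared with
      \<open>s * s = p / r\<close>, which fixes the sign of the second factor.\<close>
    then have "x * y \<le> s * s" using assms s by (intro mult_mono) auto
    then have "p - r * x * y \<ge> 0" using assms s by simp
    then show ?thesis using True by simp
  next
    case False
    then have *: "s \<le> y \<and> y \<le> x" using between by (auto simp: s_def)
    then have "s * s \<le> x * y" using assms s by (intro mult_mono) auto
    then have "p - r * x * y \<le> 0" using assms s by simp
    then show ?thesis using * by (intro mult_nonpos_nonpos) auto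
  qed
qed (use assms in auto)

lemma unimodal_is_arg_max:
  fixes f :: "real \<Rightarrow> real"
  assumes "s > 0"
    and uni: "\<And>x y. \<lbrakk>0 < x; 0 < y; x \<le> y \<and> y \<le> s \<or> s \<le> y \<and> y \<le> x\<rbrakk> \<Longrightarrow> f x \<le> f y"
  shows "is_arg_max f (\<lambda>x. x > 0) s"
proof -
  have "f x \<le> f s" if "x > 0" for x
    using uni[of x s] that \<open>s > 0\<close> by linarith
  then show ?thesis using \<open>s > 0\<close> unfolding is_arg_max_def by (meson not_less)
qed

text \<open>No integer lies strictly between floor and ceiling: those below are dominated by the
  floor, those above by the ceiling, and the better of the two wins.\<close>

lemma unimodal_is_arg_max_int:
  fixes f :: "real \<Rightarrow> real"
  assumes "s > 0"
    and uni: "\<And>x y. \<lbrakk>0 < x; 0 < y; x \<le> y \<and> y \<le> s \<or> s \<le> y \<and> y \<le> x\<rbrakk> \<Longrightarrow> f x \<le> f y"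
  shows "is_arg_max (\<lambda>k::int. f (of_int k)) (\<lambda>k. k > 0) \<lfloor>s\<rfloor> \<or>
         is_arg_max (\<lambda>k::int. f (of_int k)) (\<lambda>k. k > 0) \<lceil>s\<rceil>"
proof -
  have ceil_pos: "\<lceil>s\<rceil> > 0" using \<open>s > 0\<close> by simp
  have le_floor: "f (of_int k) \<le> f (of_int \<lfloor>s\<rfloor>)" if "k > 0" "k \<le> \<lfloor>s\<rfloor>" for k
  proof (rule uni)
    show "real_of_int \<lfloor>s\<rfloor> > 0" using that by linarith
  qed (use that in auto)
  have le_ceil: "f (of_int k) \<le> f (of_int \<lceil>s\<rceil>)" if "k > 0" "k \<ge> \<lceil>s\<rceil>" for k
  proof (rule uni)
    show "real_of_int \<lceil>s\<rceil> > 0" using ceil_pos by linarith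
  qed (use that in auto)
  have split: "k \<le> \<lfloor>s\<rfloor> \<or> k \<ge> \<lceil>s\<rceil>" for k
    by linarith
  show ?thesis
  \<comment> \<open>For \<open>s < 1\<close> the floor is 0 and not admissible, so the ceiling must
    win regardless of the values of \<open>f\<close>.\<close>
  proof (cases "\<lfloor>s\<rfloor> > 0 \<and> f (of_int \<lceil>s\<rceil>) \<le> f (of_int \<lfloor>s\<rfloor>)")
    case True
    then have "f (of_int k) \<le> f (of_int \<lfloor>s\<rfloor>)" if "k > 0" for k
      using le_floor le_ceil split that by (meson order_trans)
    then show ?thesis using True unfolding is_arg_max_def by (meson not_less)
  next
    case False
    have "f (of_int k) \<le> f (of_int \<lceil>s\<rceil>)" if "k > 0" for k
    proof (cases "k \<ge> \<lceil>s\<rceil>")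
      case k: False
      then have "k \<le> \<lfloor>s\<rfloor>" using split by blast
      \<comment> \<open>A positive \<open>k\<close> below the floor makes the floor admissible, so
        the failed case test can only mean that the ceiling has the larger value.\<close>
      then have "f (of_int k) \<le> f (of_int \<lfloor>s\<rfloor>)" "\<lfloor>s\<rfloor> > 0"
        using le_floor that by (blast, linarith)
      then show ?thesis using False by linarith
    qed (use le_ceil that in blast)
    then show ?thesis using ceil_pos unfolding is_arg_max_def by (meson not_less)
  qed
qed

theorem theorem4:
  fixes \<alpha> \<omega> \<sigma> \<epsilon> \<eta> A C0 C1 D0 D1 \<gamma> l \<beta> :: real
    and G :: "real \<Rightarrow> real" and Kopt :: real
  assumes "\<alpha> > 2" and "\<omega> > 0" and "\<sigma>\<^sup>2 > 0"
    and "0 \<le> \<epsilon>" and "\<epsilon> < 1" and "0 < \<eta>" and "\<eta> \<le> 1"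
    and "A > 0" and "C0 > 0" and "C1 > 0" and "D0 > 0" and "D1 > 0"
    and "0 \<le> \<gamma>" and "\<epsilon> > 0 \<longrightarrow> \<gamma> < - 2 * log 2 \<epsilon>"
    and "l > 0" and "\<beta> > 1"
    and "\<beta> - 1 - sinr_factor \<gamma> \<epsilon> * (2 / (\<alpha> - 2)) > 0"
    and G: "\<And>K. G K = energy_efficiency A C0 C1 D0 D1 \<eta> \<gamma>
                          (rho_star \<alpha> \<omega> \<sigma> \<epsilon> \<gamma> l (\<beta> * K) K) (\<beta> * K) K"
    and Kopt: "Kopt = K_star \<alpha> \<omega> \<sigma> \<epsilon> \<gamma> l \<eta> C0 D1 \<beta>"
  shows "is_arg_max G (\<lambda>K. K > 0) Kopt \<and>
         (Kopt \<notin> \<int> \<longrightarrow>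
            is_arg_max (\<lambda>k::int. G (of_int k)) (\<lambda>k. k > 0) \<lfloor>Kopt\<rfloor> \<or>
            is_arg_max (\<lambda>k::int. G (of_int k)) (\<lambda>k. k > 0) \<lceil>Kopt\<rceil>)"
proof -
  \<comment> \<open>With \<open>M = \<beta> * K\<close> the denominator of \<rho> is
    \<open>K * d\<close> and its numerator is \<open>N\<close>; \<open>p\<close>, \<open>q\<close>,
    \<open>r\<close> collect the coefficients of the powers of \<open>K\<close>.\<close>
  define d where "d = \<beta> - 1 - sinr_factor \<gamma> \<epsilon> * (2 / (\<alpha> - 2))"
  define g where "g = \<omega> * \<sigma>\<^sup>2 * Gamma (\<alpha> / 2 + 1) / (pi * l) powr (\<alpha> / 2)"
  define N where "N = sinr_factor \<gamma> \<epsilon> * g"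
  define p where "p = N / (\<eta> * d) + C0"
  define q where "q = C1 + D0 * \<beta> + A * \<gamma>"
  define r where "r = \<beta> * D1"
  have d: "d > 0" using assms by (simp add: d_def)
  have "Gamma (\<alpha> / 2 + 1) > 0" using assms by (intro Gamma_real_pos) auto
  then have "g \<ge> 0" using assms by (simp add: g_def)
  then have "N \<ge> 0"
    using assms sinr_factor_nonneg[of \<epsilon> \<gamma>] by (simp add: N_def)
  \<comment> \<open>For \<open>\<gamma> = 0\<close> the number \<open>N\<close> vanishes, so
    strictness comes from \<open>C0\<close>.\<close>
  then have p: "p > 0" using assms d by (simp add: p_def add_nonneg_pos)
  have q: "q > 0" using assms by (simp add: q_def add_pos_nonneg)
  have r: "r > 0" using assms by (simp add: r_def)

  have G_eq: "G K = K * \<gamma> / (p + q * K + r * K\<^sup>2)" if "K > 0" for K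
  proof -
    have "\<beta> * K - K - sinr_factor \<gamma> \<epsilon> * (2 * K / (\<alpha> - 2)) = K * d"
      by (simp add: d_def algebra_simps)
    then have "rho_star \<alpha> \<omega> \<sigma> \<epsilon> \<gamma> l (\<beta> * K) K = N / (K * d)"
      by (simp add: rho_star_def N_def g_def)
    then have "K * rho_star \<alpha> \<omega> \<sigma> \<epsilon> \<gamma> l (\<beta> * K) K / \<eta> = N / (\<eta> * d)"
      using that by (simp add: mult_ac)
    then show ?thesis
      by (simp add: G energy_efficiency_def p_def q_def r_def algebra_simps power2_eq_square)
  qed
  \<comment> \<open>Dividing the two summands of \<open>p\<close> by \<open>r\<close> gives the two
    summands under the root in \<open>K_star\<close>.\<close>
  have Kopt_eq: "Kopt = sqrt (p / r)"
  proof -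
    have "sinr_factor \<gamma> \<epsilon> * (\<omega> * \<sigma>\<^sup>2 * Gamma (\<alpha> / 2 + 1) / (\<eta> * (pi * l) powr (\<alpha> / 2)))
        = N / \<eta>"
      by (simp add: N_def g_def mult_ac)
    then show ?thesis
      unfolding Kopt K_star_def d_def[symmetric]
      by (simp add: p_def r_def add_divide_distrib mult_ac)
  qed
  have "Kopt > 0" using Kopt_eq p r by simp
  have uni: "G x \<le> G y"
    if "0 < x" "0 < y" "x \<le> y \<and> y \<le> Kopt \<or> Kopt \<le> y \<and> y \<le> x" for x y
    unfolding G_eq[OF that(1)] G_eq[OF that(2)]
    using that \<open>0 \<le> \<gamma>\<close> p q r by (intro ratio_unimodal) (simp_all only: Kopt_eq)
  show ?thesis
    using unimodal_is_arg_max[of Kopt G] unimodal_is_arg_max_int[of Kopt G] \<open>Kopt > 0\<close> uni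
    by blast
qed

end
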